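(* Let $(X,d_X)$ be a locally compact metric space whose metric $d_X$ is proper, and let $A,B\subset X$ be non-empty closed subsets. The following are equivalent: (1) $[d_A]=[d_B]$ in $M(X)$; (2) there exists $C>0$ such that $A$ lies in the $C$-neighborhood of $B$ and $B$ lies in the $C$-neighborhood of $A$; (3) $\bar A\setminus A=\bar B\setminus B$ in the Higson corona $\nu X$, where $\bar A,\bar B$ are the closures of $A,B$ in the Higson compactification $hX$.
   Context: Write $x$ for $(x,0)$ and $x'$ for $(x,1)$ in $X\times\{0,1\}$. $\mathcal M(X)$ is the set of all metrics $d$ on $X\times\{0,1\}$ whose restriction to each of the two copies of $X$ equals $d_X$ and for which $\inf_{x,y\in X}d(x,y')>0$. For $d_1,d_2\in\mathcal M(X)$, $d_1\sim d_2$ if there exist $\alpha>0$, $\beta\ge 1$ with $-\alpha+\frac1\beta d_1(x,y')\le d_2(x,y')\le\alpha+\beta d_1(x,y')$ for all $x,y\in X$. $[d]$ is the class of $d$ and $M(X)=\mathcal M(X)/\sim$. For $A\subset X$ the metric $d_A\in\mathcal M(X)$ is defined by $d_A(x,y')=\inf_{z\in A}[d_X(x,z)+1+d_X(z,y)]$, $x,y\in X$. Higson compactification: $C_h(X)$ is the $C^*$-algebra of bounded continuous functions $f$ on $X$ such that $\lim_{x\to\infty}\operatorname{Var}_r(f)(x)=0$ for every $r>0$, where $\operatorname{Var}_r(f)(x)=\sup\{|f(x)-f(y)|:y\in X,\ d_X(x,y)\le r\}$. $hX$ is the Gelfand dual of $C_h(X)$, which contains $X$, and $\nu X=hX\setminus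 X$ (the Gelfand dual of $C_h(X)/C_0(X)$) is the Higson corona. *)

theory Defs
  imports "HOL-Analysis.Analysis"
begin

text \<open>
  The space \<open>X\<close> is a type of class \<^class>\<open>metric_space\<close>, with \<open>d_X\<close> its \<^const>\<open>dist\<close>.
  The double \<open>X \<times> {0,1}\<close> is \<open>'a \<times> bool\<close>, with \<open>x = (x, False)\<close> and \<open>x' = (x, True)\<close>.
\<close>

section \<open>Metrics on the double of a metric space\<close>

definition double_metrics :: "('a::metric_space \<times> bool \<Rightarrow> 'a \<times> bool \<Rightarrow> real) set" where
  "double_metrics =
     {d. Metric_space UNIV d \<and>
         (\<forall>i x y. d (x, i) (y, i) = dist x y) \<and>
         (INF (x, y)\<in>UNIV. d (x, False) (y, True)) > 0}"

definition double_equiv ::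
    "(('a::metric_space \<times> bool \<Rightarrow> 'a \<times> bool \<Rightarrow> real) \<times> ('a \<times> bool \<Rightarrow> 'a \<times> bool \<Rightarrow> real)) set" where
  "double_equiv =
     {(d1, d2). d1 \<in> double_metrics \<and> d2 \<in> double_metrics \<and>
        (\<exists>\<alpha>>0. \<exists>\<beta>\<ge>1. \<forall>x y.
           - \<alpha> + 1 / \<beta> * d1 (x, False) (y, True) \<le> d2 (x, False) (y, True) \<and>
           d2 (x, False) (y, True) \<le> \<alpha> + \<beta> * d1 (x, False) (y, True))}"

text \<open>The set \<open>M(X)\<close>, and the class \<open>[d]\<close> of \<open>d\<close>.\<close>

definition double_classes :: "('a::metric_space \<times> bool \<Rightarrow> 'a \<times> bool \<Rightarrow> real) set set" where
  "double_classes = double_metrics // double_equiv"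

definition double_class ::
    "('a::metric_space \<times> bool \<Rightarrow> 'a \<times> bool \<Rightarrow> real) \<Rightarrow> ('a \<times> bool \<Rightarrow> 'a \<times> bool \<Rightarrow> real) set" where
  "double_class d = double_equiv `` {d}"

fun set_metric :: "'a::metric_space set \<Rightarrow> 'a \<times> bool \<Rightarrow> 'a \<times> bool \<Rightarrow> real" where
  "set_metric A (x, False) (y, True) = (INF z\<in>A. dist x z + 1 + dist z y)"
| "set_metric A (x, True) (y, False) = (INF z\<in>A. dist y z + 1 + dist z x)"
| "set_metric A (x, False) (y, False) = dist x y"
| "set_metric A (x, True) (y, True) = dist x y"

lemma equiv_double_equiv:
  "equiv (double_metrics :: ('a::metric_space \<times> bool \<Rightarrow> 'a \<times> bool \<Rightarrow> real) set) double_equiv"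
    (is "equiv ?M ?R")
proof (rule equivI)
  show "?R \<subseteq> ?M \<times> ?M"
    by (auto simp: double_equiv_def)
  show "refl_on ?M ?R"
    unfolding refl_on_def double_equiv_def
    by (auto intro!: exI[of _ "1::real"])
  show "sym ?R"
  proof (rule symI)
    fix d1 d2 :: "'a \<times> bool \<Rightarrow> 'a \<times> bool \<Rightarrow> real"
    assume "(d1, d2) \<in> double_equiv"
    then obtain \<alpha> \<beta> where d: "d1 \<in> double_metrics" "d2 \<in> double_metrics"
      and ab: "\<alpha> > 0" "\<beta> \<ge> 1" and
      le: "\<And>x y. - \<alpha> + 1 / \<beta> * d1 (x, False) (y, True) \<le> d2 (x, False) (y, True)"
      "\<And>x y. d2 (x, False) (y, True) \<le> \<alpha> + \<beta> * d1 (x, False) (y, True)"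
      by (auto simp: double_equiv_def)
    have *: "\<alpha> \<le> \<alpha> * (\<beta> * \<beta>)"
      using ab mult_mono[of 1 \<beta> 1 \<beta>] by simp
    have "- (\<alpha> * \<beta>) + 1 / \<beta> * d2 (x, False) (y, True) \<le> d1 (x, False) (y, True) \<and>
        d1 (x, False) (y, True) \<le> \<alpha> * \<beta> + \<beta> * d2 (x, False) (y, True)" for x y
      using le[of x y] ab order_trans[OF le(2)[of x y] add_right_mono[OF *]]
      by (simp add: field_simps)
    moreover have "\<alpha> * \<beta> > 0" using ab by simp
    ultimately show "(d2, d1) \<in> double_equiv"
      using d ab unfolding double_equiv_def mem_Collect_eq prod.case by blast
  qed
  show "trans ?R"
  proof (rule transI)
    fix d1 d2 d3 :: "'a \<times> bool \<Rightarrow> 'a \<times> bool \<Rightarrow> real"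
    assume "(d1, d2) \<in> double_equiv" "(d2, d3) \<in> double_equiv"
    then obtain a b a' b' where d: "d1 \<in> double_metrics" "d3 \<in> double_metrics"
      and ab: "a > 0" "b \<ge> 1" "a' > 0" "b' \<ge> 1" and
      le: "\<And>x y. - a + 1 / b * d1 (x, False) (y, True) \<le> d2 (x, False) (y, True)"
      "\<And>x y. d2 (x, False) (y, True) \<le> a + b * d1 (x, False) (y, True)"
      "\<And>x y. - a' + 1 / b' * d2 (x, False) (y, True) \<le> d3 (x, False) (y, True)"
      "\<And>x y. d3 (x, False) (y, True) \<le> a' + b' * d2 (x, False) (y, True)"
      by (auto simp: double_equiv_def)
    have "- (a' + b' * a) + 1 / (b * b') * d1 (x, False) (y, True) \<le> d3 (x, False) (y, True) \<and>
        d3 (x, False) (y, True) \<le> (a' + b' * a) + (b * b') * d1 (x, False) (y, True)" for x y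
    proof
      have "b' * d2 (x, False) (y, True) \<le> b' * (a + b * d1 (x, False) (y, True))"
        using le(2)[of x y] ab by (intro mult_left_mono) auto
      then show "d3 (x, False) (y, True) \<le> (a' + b' * a) + (b * b') * d1 (x, False) (y, True)"
        using le(4)[of x y] by (simp add: algebra_simps)
      have "1 / b' * (- a + 1 / b * d1 (x, False) (y, True)) \<le> 1 / b' * d2 (x, False) (y, True)"
        using le(1)[of x y] ab by (intro mult_left_mono) auto
      moreover have "1 / b' * a \<le> b' * a"
        using ab by (intro mult_right_mono) (auto simp: field_simps intro: order_trans[of _ b'])
      ultimately show "- (a' + b' * a) + 1 / (b * b') * d1 (x, False) (y, True)
          \<le> d3 (x, False) (y, True)"
        using le(3)[of x y] by (simp add: algebra_simps)
    qed
    moreover have "a' + b' * a > 0" "b * b' \<ge> 1"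
      using ab mult_mono[of 1 b 1 b'] by (auto intro: add_pos_pos)
    ultimately show "(d1, d3) \<in> double_equiv"
      using d unfolding double_equiv_def mem_Collect_eq prod.case by blast
  qed
qed

lemma set_metric_in_double_metrics:
  fixes A :: "'a::metric_space set"
  assumes "A \<noteq> {}"
  shows "set_metric A \<in> double_metrics"
proof -
  define g where "g x y = (INF z\<in>A. dist x z + 1 + dist z y)" for x y
  have ge1: "g x y \<ge> 1" for x y
    unfolding g_def using assms by (intro cINF_greatest) auto
  have bdd: "bdd_below ((\<lambda>z. dist x z + 1 + dist z y) ` A)" for x y
    by (rule bdd_belowI2[where m = 0]) simp
  have le: "g x y \<le> dist x z + 1 + dist z y" if "z \<in> A" for x y z
    unfolding g_def by (rule cINF_lower[OF bdd that])
  have ge: "c \<le> g x y" if "\<And>z. z \<in> A \<Longrightarrow> c \<le> dist x z + 1 + dist z y" for c x y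
    unfolding g_def using assms that by (intro cINF_greatest) auto
  have left: "g x y \<le> dist x u + g u y" for x y u
  proof -
    have "g x y - dist x u \<le> g u y"
    proof (rule ge)
      fix z assume "z \<in> A"
      then show "g x y - dist x u \<le> dist u z + 1 + dist z y"
        using le[of z x y] dist_triangle[of x z u] by linarith
    qed
    then show ?thesis by simp
  qed
  have right: "g x y \<le> g x v + dist v y" for x y v
  proof -
    have "g x y - dist v y \<le> g x v"
    proof (rule ge)
      fix z assume "z \<in> A"
      then show "g x y - dist v y \<le> dist x z + 1 + dist z v"
        using le[of z x y] dist_triangle[of z y v] by linarith
    qed
    then show ?thesis by simp
  qed
  have dle: "dist x u \<le> g x y + g u y" "dist x u \<le> g y x + g y u" for x u y
  proof -
    have "dist x u - g u y \<le> g x y"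
    proof (rule ge)
      fix z assume z: "z \<in> A"
      have "dist x u - (dist x z + 1 + dist z y) \<le> g u y"
      proof (rule ge)
        fix w assume w: "w \<in> A"
        show "dist x u - (dist x z + 1 + dist z y) \<le> dist u w + 1 + dist w y"
          using dist_triangle[of x u z] dist_triangle[of z u y] dist_triangle[of y u w]
          by (simp add: dist_commute)
      qed
      then show "dist x u - g u y \<le> dist x z + 1 + dist z y" by linarith
    qed
    then show "dist x u \<le> g x y + g u y" by simp
  next
    have "dist x u - g y u \<le> g y x"
    proof (rule ge)
      fix z assume z: "z \<in> A"
      have "dist x u - (dist y z + 1 + dist z x) \<le> g y u"
      proof (rule ge)
        fix w assume w: "w \<in> A"
        show "dist x u - (dist y z + 1 + dist z x) \<le> dist y w + 1 + dist w u"
          using dist_triangle[of x u z] dist_triangle[of z u y] dist_triangle[of y u w]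
          by (simp add: dist_commute)
      qed
      then show "dist x u - g y u \<le> dist y z + 1 + dist z x" by linarith
    qed
    then show "dist x u \<le> g y x + g y u" by simp
  qed
  have sm: "set_metric A (x, i) (y, j) =
      (if i = j then dist x y else if i then g y x else g x y)" for x y i j
    by (cases i; cases j) (auto simp: g_def)
  have "Metric_space UNIV (set_metric A)"
  proof
    fix p q r :: "'a \<times> bool"
    obtain x i y j z k where p: "p = (x, i)" "q = (y, j)" "r = (z, k)"
      by (metis surj_pair)
    show "0 \<le> set_metric A p q"
      unfolding p sm using ge1[of x y] ge1[of y x] by auto
    show "set_metric A p q = set_metric A q p"
      unfolding p sm by (auto simp: dist_commute)
    show "set_metric A p q = 0 \<longleftrightarrow> p = q"
      unfolding p sm using ge1[of x y] ge1[of y x] by auto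
    show "set_metric A p r \<le> set_metric A p q + set_metric A q r"
      unfolding p sm
      using left[of x z y] right[of x z y] left[of z x y] right[of z x y]
        dle[of x z y] dist_triangle[of x z y]
      by (auto simp: dist_commute)
  qed
  moreover have "(INF (x, y)\<in>UNIV. set_metric A (x, False) (y, True)) \<ge> 1"
    by (rule cINF_greatest) (use ge1 in \<open>auto simp: sm simp del: set_metric.simps\<close>)
  ultimately show ?thesis
    unfolding double_metrics_def by (auto simp: sm)
qed

section \<open>The Higson compactification\<close>

text \<open>The filter of \<open>x \<rightarrow> \<infinity>\<close> in \<open>X\<close>: leaving every compact subset.\<close>

definition at_infty :: "'a::metric_space filter" where
  "at_infty = (INF K\<in>Collect compact. principal (- K))"

definition variation :: "real \<Rightarrow> ('a::metric_space \<Rightarrow> complex) \<Rightarrow> 'a \<Rightarrow> real" where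
  "variation r f x = (SUP y\<in>cball x r. cmod (f x - f y))"

text \<open>
  The underlying set of \<open>C_h(X)\<close>; \<^const>\<open>bcontfun\<close> is the set of bounded continuous functions.
\<close>

definition higson_functions :: "('a::metric_space \<Rightarrow> complex) set" where
  "higson_functions = {f \<in> bcontfun. \<forall>r>0. (variation r f \<longlongrightarrow> 0) at_infty}"

text \<open>
  Characters (nonzero multiplicative linear functionals) of an algebra \<open>\<A>\<close> of complex functions
  under pointwise operations. They are made extensional, so that each character is represented
  by a single function, and topologised by pointwise convergence on \<open>\<A>\<close>, i.e. by the weak-*
  topology.
\<close>

definition characters :: "('a \<Rightarrow> complex) set \<Rightarrow> (('a \<Rightarrow> complex) \<Rightarrow> complex) set" where
  "characters \<A> =
     {\<phi> \<in> extensional \<A>.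
        (\<forall>f\<in>\<A>. \<forall>g\<in>\<A>. \<phi> (\<lambda>x. f x + g x) = \<phi> f + \<phi> g) \<and>
        (\<forall>c. \<forall>f\<in>\<A>. \<phi> (\<lambda>x. c * f x) = c * \<phi> f) \<and>
        (\<forall>f\<in>\<A>. \<forall>g\<in>\<A>. \<phi> (\<lambda>x. f x * g x) = \<phi> f * \<phi> g) \<and>
        (\<exists>f\<in>\<A>. \<phi> f \<noteq> 0)}"

definition gelfand_dual :: "('a \<Rightarrow> complex) set \<Rightarrow> (('a \<Rightarrow> complex) \<Rightarrow> complex) topology" where
  "gelfand_dual \<A> = subtopology (product_topology (\<lambda>_. euclidean) \<A>) (characters \<A>)"

definition higson_compactification :: "(('a::metric_space \<Rightarrow> complex) \<Rightarrow> complex) topology" where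
  "higson_compactification = gelfand_dual higson_functions"

text \<open>The inclusion of \<open>X\<close> in \<open>hX\<close>: a point is sent to the evaluation at that point.\<close>

definition higson_point :: "'a::metric_space \<Rightarrow> (('a \<Rightarrow> complex) \<Rightarrow> complex)" where
  "higson_point x = (\<lambda>f\<in>higson_functions. f x)"

definition higson_corona :: "(('a::metric_space \<Rightarrow> complex) \<Rightarrow> complex) set" where
  "higson_corona = topspace higson_compactification - range higson_point"

text \<open>The trace \<open>closure A \<setminus> A\<close>, the closure being taken in \<open>hX\<close>.\<close>

definition higson_boundary :: "'a::metric_space set \<Rightarrow> (('a \<Rightarrow> complex) \<Rightarrow> complex) set" where
  "higson_boundary A = (higson_compactification closure_of (higson_point ` A)) - higson_point ` A"

lemma topspace_higson_compactification:
  "topspace higson_compactification = characters higson_functions"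
  by (auto simp: higson_compactification_def gelfand_dual_def characters_def PiE_def)

lemma eventually_at_infty:
  "eventually P at_infty \<longleftrightarrow> (\<exists>K::'a::metric_space set. compact K \<and> (\<forall>x. x \<notin> K \<longrightarrow> P x))"
proof -
  have "eventually P at_infty \<longleftrightarrow> (\<exists>K\<in>Collect (compact :: 'a set \<Rightarrow> bool). eventually P (principal (- K)))"
    unfolding at_infty_def
  proof (rule eventually_INF_base)
    show "Collect (compact :: 'a set \<Rightarrow> bool) \<noteq> {}"
      by (auto intro: exI[of _ "{}"])
    fix K L :: "'a set"
    assume "K \<in> Collect compact" "L \<in> Collect compact"
    then show "\<exists>M\<in>Collect compact. principal (- M) \<le> inf (principal (- K)) (principal (- L))"
      by (intro bexI[of _ "K \<union> L"]) auto
  qed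
  then show ?thesis by (auto simp: eventually_principal)
qed

lemma bump_in_higson_functions:
  fixes x :: "'a::metric_space"
  assumes proper: "\<And>(z::'a) r. compact (cball z r)" and "e > 0"
  shows "(\<lambda>y. of_real (max 0 (e - dist x y))) \<in> higson_functions" (is "?f \<in> _")
proof -
  have "?f \<in> bcontfun"
  proof -
    have "cmod (?f y) \<le> e" for y using assms by auto
    then have "bounded (range ?f)" unfolding bounded_iff by blast
    then show ?thesis unfolding bcontfun_def by (auto intro!: continuous_intros)
  qed
  moreover have "(variation r ?f \<longlongrightarrow> 0) at_infty" if "r > 0" for r
  proof (rule tendsto_eventually)
    have "variation r ?f y = 0" if y: "y \<notin> cball x (e + r)" for y
    proof -
      have "cmod (?f y - ?f z) = 0" if "z \<in> cball y r" for z
        using that y \<open>r > 0\<close> dist_triangle[of x y z] by (auto simp: dist_commute)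
      then have "variation r ?f y = (SUP z\<in>cball y r. (0::real))"
        unfolding variation_def by (intro SUP_cong) auto
      then show ?thesis using \<open>r > 0\<close> by simp
    qed
    then show "eventually (\<lambda>y. variation r ?f y = 0) at_infty"
      unfolding eventually_at_infty using proper by blast
  qed
  ultimately show ?thesis by (simp add: higson_functions_def)
qed

lemma higson_boundary_subset_corona:
  fixes A :: "'a::metric_space set"
  assumes proper: "\<And>(z::'a) r. compact (cball z r)" and "closed A"
  shows "higson_boundary A \<subseteq> higson_corona"
proof
  fix \<phi> assume \<phi>: "\<phi> \<in> higson_boundary A"
  then have cl: "\<phi> \<in> higson_compactification closure_of (higson_point ` A)"
    and n: "\<phi> \<notin> higson_point ` A"
    by (auto simp: higson_boundary_def)
  have "\<phi> \<noteq> higson_point x" for x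
  proof
    assume eq: "\<phi> = higson_point x"
    with n have "x \<notin> A" by auto
    with \<open>closed A\<close> obtain e where e: "e > 0" "ball x e \<inter> A = {}"
      by (metis Compl_iff disjoint_eq_subset_Compl open_Compl open_contains_ball)
    define f :: "'a \<Rightarrow> complex" where "f = (\<lambda>y. of_real (max 0 (e - dist x y)))"
    have f: "f \<in> higson_functions"
      unfolding f_def by (rule bump_in_higson_functions[OF proper e(1)])
    define T where "T = {\<psi> \<in> topspace higson_compactification. \<psi> f \<in> - {0}}"
    have "continuous_map higson_compactification euclidean (\<lambda>\<psi>. \<psi> f)"
      unfolding higson_compactification_def gelfand_dual_def
      by (intro continuous_map_from_subtopology continuous_map_product_projection f)
    then have "openin higson_compactification T"
      unfolding T_def by (rule openin_continuous_map_preimage) auto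
    moreover have "\<phi> \<in> T"
      using cl f e(1) closure_of_subset_topspace[of higson_compactification "higson_point ` A"]
      by (auto simp: T_def eq higson_point_def f_def)
    ultimately obtain a where a: "a \<in> A" "higson_point a \<in> T"
      using cl unfolding in_closure_of by blast
    then have "f a \<noteq> 0" using f by (auto simp: T_def higson_point_def)
    then have "a \<in> ball x e" by (auto simp: f_def max_def split: if_splits)
    with a e show False by auto
  qed
  moreover have "\<phi> \<in> topspace higson_compactification"
    using cl by (simp add: in_closure_of)
  ultimately show "\<phi> \<in> higson_corona" by (auto simp: higson_corona_def)
qed

end

theory Submission
  imports Defs
begin

text \<open>
  On the diagonal the metric of \<open>A\<close> is at most \<open>1\<close> over \<open>A\<close>, while that of \<open>B\<close> is controlled by the
  distance to \<open>B\<close>, so equivalence of the two metrics bounds the Hausdorff distance. A point of the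
  boundary of \<open>A\<close> is approximated by points of \<open>A\<close> outside any given compact set, where a Higson
  function hardly changes when one moves to a point of \<open>B\<close> at bounded distance; so bounded
  Hausdorff distance gives equal boundaries. If instead \<open>A\<close> contains points arbitrarily far from
  \<open>B\<close>, a sequence \<open>S\<close> of them receding from \<open>B\<close> has an accumulation point in the corona, and
  \<open>u / (1 + u + v)\<close>, with \<open>u\<close> and \<open>v\<close> the distances to \<open>B\<close> and \<open>S\<close>, is a Higson function
  separating it from the closure of \<open>B\<close>.
\<close>

section \<open>Coarse equivalence of sets and the metrics on the double\<close>

lemma neighborhood_mono:
  assumes "A \<subseteq> (\<Union>b\<in>B. ball b C)" and "C \<le> D"
  shows "A \<subseteq> (\<Union>b\<in>B. ball b D)"
  using assms subset_ball by blast

lemma set_metric_le: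
  assumes "z \<in> A"
  shows "set_metric A (x, False) (y, True) \<le> dist x z + 1 + dist z y"
  unfolding set_metric.simps
  by (rule cINF_lower[OF bdd_belowI2[where m = 0] assms]) simp

lemma le_set_metric:
  assumes "A \<noteq> {}" and "\<And>z. z \<in> A \<Longrightarrow> c \<le> dist x z + 1 + dist z y"
  shows "c \<le> set_metric A (x, False) (y, True)"
  unfolding set_metric.simps using assms by (rule cINF_greatest)

text \<open>Replacing the crossing point \<open>z\<close> of \<open>A\<close> by a point
  \<open>b\<close> of \<open>B\<close> with \<open>dist b z < C\<close> lengthens each of the two
  legs by less than \<open>C\<close>, whence the constant \<open>2 * C\<close>.\<close>

lemma set_metric_mono_neighborhood:
  assumes "A \<noteq> {}" and sub: "A \<subseteq> (\<Union>b\<in>B. ball b C)"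
  shows "set_metric B (x, False) (y, True) \<le> 2 * C + set_metric A (x, False) (y, True)"
proof -
  have "set_metric B (x, False) (y, True) - 2 * C \<le> set_metric A (x, False) (y, True)"
  proof (rule le_set_metric[OF \<open>A \<noteq> {}\<close>])
    fix z assume "z \<in> A"
    with sub obtain b where b: "b \<in> B" "dist b z < C" by auto
    then show "set_metric B (x, False) (y, True) - 2 * C \<le> dist x z + 1 + dist z y"
      using set_metric_le[OF b(1), of x y] dist_triangle[of x b z] dist_triangle[of b y z]
      by (simp add: dist_commute)
  qed
  then show ?thesis by simp
qed

text \<open>Evaluate the inequality on the diagonal at \<open>a\<close> in \<open>A\<close>:
  crossing at \<open>a\<close> itself costs 1, while crossing through \<open>B\<close> costs 1 plus
  twice the distance to \<open>B\<close>.\<close>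

lemma neighborhood_of_set_metric_bound:
  assumes "B \<noteq> {}" and "\<beta> \<ge> 0"
    and le: "\<And>x y. set_metric B (x, False) (y, True) \<le> \<alpha> + \<beta> * set_metric A (x, False) (y, True)"
  shows "A \<subseteq> (\<Union>b\<in>B. ball b (\<alpha> + \<beta>))"
proof
  fix a assume a: "a \<in> A"
  show "a \<in> (\<Union>b\<in>B. ball b (\<alpha> + \<beta>))"
  proof (rule ccontr)
    assume "a \<notin> (\<Union>b\<in>B. ball b (\<alpha> + \<beta>))"
    then have far: "\<alpha> + \<beta> \<le> dist a b" if "b \<in> B" for b
      using that by (auto simp: dist_commute not_less)
    have "2 * dist a b \<ge> \<alpha> + \<beta>" if "b \<in> B" for b
      using far[OF that] zero_le_dist[of a b] by linarith
    \<comment> \<open>The unit cost of crossing makes this strictly larger than the bound \<alpha> +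
      \<beta> that the hypothesis gives at \<open>a\<close>.\<close>
    then have "\<alpha> + \<beta> + 1 \<le> set_metric B (a, False) (a, True)"
      by (intro le_set_metric \<open>B \<noteq> {}\<close>) (simp add: dist_commute algebra_simps)
    moreover have "\<beta> * set_metric A (a, False) (a, True) \<le> \<beta> * 1"
      using set_metric_le[OF a, of a a] \<open>\<beta> \<ge> 0\<close> by (intro mult_left_mono) auto
    ultimately show False using le[of a a] by simp
  qed
qed

lemma double_class_set_metric_eq_iff:
  fixes A B :: "'a::metric_space set"
  assumes A: "A \<noteq> {}" and B: "B \<noteq> {}"
  shows "double_class (set_metric A) = double_class (set_metric B) \<longleftrightarrow>
    (\<exists>C>0. A \<subseteq> (\<Union>b\<in>B. ball b C) \<and> B \<subseteq> (\<Union>a\<in>A. ball a C))" (is "_ = ?R")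
proof -
  note AB = set_metric_in_double_metrics[OF A] set_metric_in_double_metrics[OF B]
  have iff: "double_class (set_metric A) = double_class (set_metric B) \<longleftrightarrow>
      (set_metric A, set_metric B) \<in> double_equiv"
    unfolding double_class_def by (rule eq_equiv_class_iff[OF equiv_double_equiv AB])
  have "?R" if R: "(set_metric A, set_metric B) \<in> double_equiv"
  proof -
    have bound: "\<exists>C>0. P \<subseteq> (\<Union>q\<in>Q. ball q C)"
      if R: "(set_metric P, set_metric Q) \<in> double_equiv" and "Q \<noteq> {}" for P Q :: "'a set"
    proof -
      obtain \<alpha> \<beta> where "\<alpha> > 0" "\<beta> \<ge> 1" and le: "\<And>x y. set_metric Q (x, False) (y, True)
          \<le> \<alpha> + \<beta> * set_metric P (x, False) (y, True)"
        using R unfolding double_equiv_def mem_Collect_eq prod.case by blast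
      then show ?thesis
        using neighborhood_of_set_metric_bound[OF \<open>Q \<noteq> {}\<close> _ le] by (intro exI[of _ "\<alpha> + \<beta>"]) auto
    qed
    obtain C where C: "C > 0" "A \<subseteq> (\<Union>b\<in>B. ball b C)"
      using bound[OF R B] by blast
    have "(set_metric B, set_metric A) \<in> double_equiv"
      using equiv_double_equiv R unfolding equiv_def by (blast dest: symD)
    then obtain D where D: "D > 0" "B \<subseteq> (\<Union>a\<in>A. ball a D)"
      using bound[OF _ A] by blast
    show ?R
      using C(1) neighborhood_mono[OF C(2), of "max C D"] neighborhood_mono[OF D(2), of "max C D"]
      by (intro exI[of _ "max C D"]) auto
  qed
  moreover have "(set_metric A, set_metric B) \<in> double_equiv" if ?R
  proof -
    from that obtain C where C: "C > 0" "A \<subseteq> (\<Union>b\<in>B. ball b C)" "B \<subseteq> (\<Union>a\<in>A. ball a C)"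
      by blast
    show ?thesis
      unfolding double_equiv_def mem_Collect_eq prod.case
    proof (intro conjI exI allI AB)
      fix x y
      show "- (2 * C) + 1 / 1 * set_metric A (x, False) (y, True) \<le> set_metric B (x, False) (y, True)"
        using set_metric_mono_neighborhood[OF B C(3), of x y] by simp
      show "set_metric B (x, False) (y, True) \<le> 2 * C + 1 * set_metric A (x, False) (y, True)"
        using set_metric_mono_neighborhood[OF A C(2), of x y] by simp
    qed (use C in auto)
  qed
  ultimately show ?thesis using iff by blast
qed

section \<open>The algebra of Higson functions\<close>

text \<open>Boundedness of \<open>f\<close> makes the real supremum in \<open>variation\<close> a
  genuine upper bound.\<close>

lemma cmod_diff_le_variation:
  assumes "f \<in> bcontfun" and "dist x y \<le> r"
  shows "cmod (f x - f y) \<le> variation r f x"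
  unfolding variation_def
proof (rule cSUP_upper)
  obtain b where b: "\<And>x. cmod (f x) \<le> b"
    using assms(1) unfolding bcontfun_def bounded_iff by auto
  have "cmod (f x - f z) \<le> b + b" for z
    using norm_triangle_ineq4[of "f x" "f z"] b[of x] b[of z] by linarith
  then show "bdd_above ((\<lambda>z. cmod (f x - f z)) ` cball x r)" by (intro bdd_aboveI2)
qed (use assms in auto)

text \<open>Trades the supremum for an estimate on single pairs of points, the form in which the
  Higson condition is used from here on.\<close>

lemma higson_functions_iff:
  "f \<in> higson_functions \<longleftrightarrow> f \<in> bcontfun \<and>
     (\<forall>r>0. \<forall>e>0. \<forall>\<^sub>F x in at_infty. \<forall>y. dist x y \<le> r \<longrightarrow> cmod (f x - f y) < e)"
    (is "_ \<longleftrightarrow> _ \<and> ?V")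
proof (cases "f \<in> bcontfun")
  case True
  have nonneg: "0 \<le> variation r f x" if "r > 0" for r x
    using cmod_diff_le_variation[OF True, of x x r] that by simp
  have "(\<forall>r>0. (variation r f \<longlongrightarrow> 0) at_infty) \<longleftrightarrow> ?V"
  proof (intro iffI allI impI)
    fix r e :: real assume L: "\<forall>r>0. (variation r f \<longlongrightarrow> 0) at_infty" and "r > 0" "e > 0"
    then have "(variation r f \<longlongrightarrow> 0) at_infty" by simp
    from order_tendstoD(2)[OF this \<open>e > 0\<close>]
    show "\<forall>\<^sub>F x in at_infty. \<forall>y. dist x y \<le> r \<longrightarrow> cmod (f x - f y) < e"
    proof eventually_elim
      case (elim x)
      then show ?case using cmod_diff_le_variation[OF True, of x _ r] by (auto intro: le_less_trans)
    qed
  next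
    fix r :: real assume V: ?V and r: "r > 0"
    show "(variation r f \<longlongrightarrow> 0) at_infty"
    proof (rule tendstoI)
      fix e :: real assume "e > 0"
      \<comment> \<open>A supremum of values below \<open>e / 2\<close> is only known to be at most
        \<open>e / 2\<close>; halving keeps the final inequality strict.\<close>
      then have "\<forall>\<^sub>F x in at_infty. \<forall>y. dist x y \<le> r \<longrightarrow> cmod (f x - f y) < e / 2"
        using V r half_gt_zero[OF \<open>e > 0\<close>] by blast
      then show "\<forall>\<^sub>F x in at_infty. dist (variation r f x) 0 < e"
      proof (rule eventually_mono)
        fix x assume "\<forall>y. dist x y \<le> r \<longrightarrow> cmod (f x - f y) < e / 2"
        then have "variation r f x \<le> e / 2"
          unfolding variation_def using r by (intro cSUP_least) (auto intro: less_imp_le)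
        then show "dist (variation r f x) 0 < e"
          using nonneg[OF r, of x] \<open>e > 0\<close> by simp
      qed
    qed
  qed
  with True show ?thesis by (simp add: higson_functions_def)
qed (simp add: higson_functions_def)

lemma higson_functionsD:
  assumes "f \<in> higson_functions" "r > 0" "e > 0"
  shows "\<forall>\<^sub>F x in at_infty. \<forall>y. dist x y \<le> r \<longrightarrow> cmod (f x - f y) < e"
  using assms unfolding higson_functions_iff by blast

lemma const_in_higson_functions: "(\<lambda>_. c) \<in> higson_functions"
  by (auto simp: higson_functions_iff bcontfun_def)

text \<open>Bounded functions have values in a compact set, where \<open>h\<close> is uniformly
  continuous, so small variation of \<open>f\<close> and \<open>g\<close> passes to the composite.
  Sums and products are both instances.\<close>

lemma compose_in_higson_functions:
  assumes f: "f \<in> higson_functions" and g: "g \<in> higson_functions"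
    and h: "continuous_on UNIV h"
  shows "(\<lambda>x. h (f x, g x)) \<in> higson_functions"
proof -
  have bf: "continuous_on UNIV f" "bounded (range f)" and bg: "continuous_on UNIV g" "bounded (range g)"
    using f g by (auto simp: higson_functions_def bcontfun_def)
  define K where "K = closure (range f) \<times> closure (range g)"
  have K: "compact K"
    unfolding K_def using bf bg by (intro compact_Times) (auto simp: compact_closure)
  have inK: "(f x, g x) \<in> K" for x
    unfolding K_def by (simp add: closure_subset[THEN subsetD])
  have hK: "continuous_on K h" by (rule continuous_on_subset[OF h]) simp
  have "bounded (range (\<lambda>x. h (f x, g x)))"
    by (rule bounded_subset[OF compact_imp_bounded[OF compact_continuous_image[OF hK K]]])
      (use inK in auto)
  moreover have "continuous_on UNIV (\<lambda>x. h (f x, g x))"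
    by (rule continuous_on_compose2[OF h continuous_on_Pair[OF bf(1) bg(1)]]) simp
  moreover have "\<forall>\<^sub>F x in at_infty. \<forall>y. dist x y \<le> r \<longrightarrow> cmod (h (f x, g x) - h (f y, g y)) < e"
    if "r > 0" "e > 0" for r e
  proof -
    obtain d where d: "d > 0"
      "\<And>p q. p \<in> K \<Longrightarrow> q \<in> K \<Longrightarrow> dist q p < d \<Longrightarrow> dist (h q) (h p) < e"
      using compact_uniformly_continuous[OF hK K] \<open>e > 0\<close>
      unfolding uniformly_continuous_on_def by blast
    have "\<forall>\<^sub>F x in at_infty. \<forall>y. dist x y \<le> r \<longrightarrow> cmod (k x - k y) < d / 2"
      if "k \<in> higson_functions" for k
      by (rule higson_functionsD[OF that \<open>r > 0\<close>]) (simp add: d(1))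
    from this[OF f] this[OF g] show ?thesis
    proof eventually_elim
      case (elim x)
      show ?case
      proof (intro allI impI)
        fix y assume "dist x y \<le> r"
        then have "dist (f x) (f y) < d / 2" "dist (g x) (g y) < d / 2"
          using elim by (auto simp: dist_norm)
        then have "dist (f x, g x) (f y, g y) < d"
          using sqrt_sum_squares_le_sum[of "dist (f x) (f y)" "dist (g x) (g y)"]
          by (auto simp: dist_Pair_Pair)
        then show "cmod (h (f x, g x) - h (f y, g y)) < e"
          using d(2)[OF inK inK] by (simp add: dist_norm)
      qed
    qed
  qed
  ultimately show ?thesis by (simp add: higson_functions_iff bcontfun_def)
qed

lemma add_in_higson_functions:
  assumes "f \<in> higson_functions" "g \<in> higson_functions"
  shows "(\<lambda>x. f x + g x) \<in> higson_functions"
proof -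
  have "continuous_on UNIV (\<lambda>p::complex \<times> complex. fst p + snd p)"
    by (intro continuous_intros)
  from compose_in_higson_functions[OF assms this] show ?thesis by simp
qed

lemma mult_in_higson_functions:
  assumes "f \<in> higson_functions" "g \<in> higson_functions"
  shows "(\<lambda>x. f x * g x) \<in> higson_functions"
proof -
  have "continuous_on UNIV (\<lambda>p::complex \<times> complex. fst p * snd p)"
    by (intro continuous_intros)
  from compose_in_higson_functions[OF assms this] show ?thesis by simp
qed

section \<open>Closures in the Higson compactification\<close>

text \<open>The ambient product of which the compactification is a subspace; its basic open sets are
  boxes restricting finitely many coordinates.\<close>

abbreviation higson_product :: "(('a::metric_space \<Rightarrow> complex) \<Rightarrow> complex) topology" where
  "higson_product \<equiv> product_topology (\<lambda>_. euclidean) higson_functions"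

lemma higson_compactification_alt:
  "higson_compactification = subtopology higson_product (characters higson_functions)"
  by (simp add: higson_compactification_def gelfand_dual_def)

lemma continuous_map_eval:
  "f \<in> higson_functions \<Longrightarrow> continuous_map higson_product euclidean (\<lambda>\<psi>. \<psi> f)"
  by (rule continuous_map_product_projection)

text \<open>Each identity defining a character equates two continuous functions of
  \<open>\<psi>\<close> that agree at all evaluations, hence also at their limits.\<close>

lemma closure_higson_points_subset_characters:
  fixes A :: "'a::metric_space set"
  assumes cl: "\<phi> \<in> higson_product closure_of (higson_point ` A)"
  shows "\<phi> \<in> characters higson_functions"
proof -
  have eq: "p \<phi> = q \<phi>"
    if "continuous_map higson_product euclidean p" "continuous_map higson_product euclidean q"
      "\<And>a. p (higson_point a) = q (higson_point a)"
    for p q :: "(('a \<Rightarrow> complex) \<Rightarrow> complex) \<Rightarrow> complex"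
    using forall_in_closure_of_eq[OF cl _ that(1,2)] that(3) by auto
  have continuous_map_mult: "continuous_map higson_product euclidean (\<lambda>\<psi>. p \<psi> * q \<psi>)"
    if "continuous_map higson_product euclidean p" "continuous_map higson_product euclidean q"
    for p q :: "(('a \<Rightarrow> complex) \<Rightarrow> complex) \<Rightarrow> complex"
    using that by (simp add: continuous_map_atin tendsto_mult)
  note cont = continuous_map_eval add_in_higson_functions mult_in_higson_functions
    const_in_higson_functions continuous_map_add continuous_map_mult
  have add: "\<phi> (\<lambda>x. f x + g x) = \<phi> f + \<phi> g"
    if "f \<in> higson_functions" "g \<in> higson_functions" for f g
    by (rule eq[where p = "\<lambda>\<psi>. \<psi> (\<lambda>x. f x + g x)" and q = "\<lambda>\<psi>. \<psi> f + \<psi> g"])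
      (use that in \<open>auto intro!: cont simp: higson_point_def add_in_higson_functions\<close>)
  have mult: "\<phi> (\<lambda>x. f x * g x) = \<phi> f * \<phi> g"
    if "f \<in> higson_functions" "g \<in> higson_functions" for f g
    by (rule eq[where p = "\<lambda>\<psi>. \<psi> (\<lambda>x. f x * g x)" and q = "\<lambda>\<psi>. \<psi> f * \<psi> g"])
      (use that in \<open>auto intro!: cont simp: higson_point_def mult_in_higson_functions\<close>)
  \<comment> \<open>The values at constants yield both that \<open>\<phi>\<close> is nonzero and,
    through \<open>mult\<close>, that it is homogeneous.\<close>
  have const: "\<phi> (\<lambda>_. c) = c" for c
    by (rule eq[where p = "\<lambda>\<psi>. \<psi> (\<lambda>_. c)" and q = "\<lambda>_. c"])
      (auto intro!: cont simp: higson_point_def const_in_higson_functions)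
  have "\<phi> \<in> extensional higson_functions"
    using cl by (auto simp: in_closure_of PiE_def)
  moreover have "\<exists>f\<in>higson_functions. \<phi> f \<noteq> 0"
    using const[of 1] const_in_higson_functions[of 1] by force
  ultimately show ?thesis
    unfolding characters_def
    using add mult mult[OF const_in_higson_functions] const by auto
qed

lemma closure_of_higson_points:
  "higson_compactification closure_of (higson_point ` A) =
     higson_product closure_of (higson_point ` A)"
proof -
  have "higson_point ` A \<subseteq> higson_product closure_of (higson_point ` A)"
    by (intro closure_of_subset) (auto simp: higson_point_def)
  then have "higson_point ` A \<subseteq> characters higson_functions"
    using closure_higson_points_subset_characters by blast
  then show ?thesis
    using closure_higson_points_subset_characters
    by (auto simp: higson_compactification_alt closure_of_subtopology Int_absorb1)
qed

lemma in_closure_higson_points_iff: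
  fixes A :: "'a::metric_space set"
  shows "\<phi> \<in> higson_compactification closure_of (higson_point ` A) \<longleftrightarrow>
     \<phi> \<in> topspace higson_product \<and>
     (\<forall>F e. finite F \<longrightarrow> F \<subseteq> higson_functions \<longrightarrow> e > 0 \<longrightarrow> (\<exists>a\<in>A. \<forall>f\<in>F. cmod (f a - \<phi> f) < e))"
  (is "_ \<longleftrightarrow> _ \<and> ?N")
proof -
  have "?N" if cl: "\<phi> \<in> higson_product closure_of (higson_point ` A)"
  proof (intro allI impI)
    fix F :: "('a \<Rightarrow> complex) set" and e :: real
    assume F: "finite F" "F \<subseteq> higson_functions" and "e > 0"
    define X where "X = (\<lambda>f. if f \<in> F then ball (\<phi> f) e else UNIV)"
    have "openin higson_product (PiE higson_functions X)"
    proof (rule product_topology_basis)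
      show "finite {i. X i \<noteq> topspace euclidean}"
        by (rule finite_subset[OF _ F(1)]) (auto simp: X_def)
    qed (auto simp: X_def)
    moreover have "\<phi> \<in> PiE higson_functions X"
      using cl \<open>e > 0\<close> by (auto simp: in_closure_of X_def PiE_def)
    ultimately obtain a where "a \<in> A" "higson_point a \<in> PiE higson_functions X"
      using cl unfolding in_closure_of by blast
    have "cmod (f a - \<phi> f) < e" if "f \<in> F" for f
    proof -
      have "f \<in> higson_functions" using F that by blast
      then have "f a \<in> X f"
        using PiE_mem[OF \<open>higson_point a \<in> PiE higson_functions X\<close>, of f] by (simp add: higson_point_def)
      then show ?thesis using that by (simp add: X_def dist_norm norm_minus_commute)
    qed
    with \<open>a \<in> A\<close> show "\<exists>a\<in>A. \<forall>f\<in>F. cmod (f a - \<phi> f) < e" by blast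
  qed
  moreover have "\<phi> \<in> higson_product closure_of (higson_point ` A)"
    if top: "\<phi> \<in> topspace higson_product" and N: ?N
    unfolding in_closure_of
  proof (intro conjI top allI impI, elim conjE)
    fix T assume "\<phi> \<in> T" "openin higson_product T"
    then obtain X where X: "\<phi> \<in> PiE higson_functions X" "\<And>f. open (X f)"
      "finite {f. X f \<noteq> UNIV}" "PiE higson_functions X \<subseteq> T"
      using product_topology_open_contains_basis[of "\<lambda>_. euclidean" higson_functions T \<phi>] by auto
    define F where "F = {f \<in> higson_functions. X f \<noteq> UNIV}"
    have fin: "finite F" using X(3) by (auto simp: F_def)
    have "\<exists>d>0. ball (\<phi> f) d \<subseteq> X f" if "f \<in> F" for f
      by (rule openE[OF X(2)[of f] PiE_mem[OF X(1)]]) (use that in \<open>auto simp: F_def\<close>)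
    then obtain d where d: "\<And>f. f \<in> F \<Longrightarrow> d f > 0 \<and> ball (\<phi> f) (d f) \<subseteq> X f" by metis
    \<comment> \<open>Inserting 1 keeps the minimum defined and positive when \<open>F\<close> is
      empty.\<close>
    define e where "e = Min (insert 1 (d ` F))"
    have e: "e > 0" "\<And>f. f \<in> F \<Longrightarrow> e \<le> d f"
      unfolding e_def using fin d by auto
    obtain a where a: "a \<in> A" "\<And>f. f \<in> F \<Longrightarrow> cmod (f a - \<phi> f) < e"
      using N[rule_format, OF fin _ e(1)] by (auto simp: F_def)
    have "f a \<in> X f" if "f \<in> higson_functions" for f
    proof (cases "f \<in> F")
      case True
      then have "f a \<in> ball (\<phi> f) (d f)"
        using a(2)[OF True] e(2)[OF True] by (simp add: dist_norm norm_minus_commute)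
      then show ?thesis using d[OF True] by blast
    qed (use that in \<open>auto simp: F_def\<close>)
    then have "higson_point a \<in> PiE higson_functions X"
      by (auto simp: higson_point_def)
    with a(1) X(4) show "\<exists>y. y \<in> higson_point ` A \<and> y \<in> T" by blast
  qed
  moreover have "\<phi> \<in> topspace higson_product" if "\<phi> \<in> higson_product closure_of (higson_point ` A)"
    using that by (simp add: in_closure_of)
  ultimately show ?thesis unfolding closure_of_higson_points by blast
qed

section \<open>Boundaries of sets at bounded distance\<close>

text \<open>The image of \<open>K\<close> is compact in a Hausdorff space, hence closed, so the part
  of \<open>A\<close> inside \<open>K\<close> contributes only evaluations to the closure.\<close>

lemma higson_corona_closure_avoids_compact:
  fixes A :: "'a::metric_space set"
  assumes "compact K" and cl: "\<phi> \<in> higson_compactification closure_of (higson_point ` A)"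
    and "\<phi> \<notin> range higson_point"
  shows "\<phi> \<in> higson_compactification closure_of (higson_point ` (A - K))"
proof -
  have "continuous_map euclidean higson_product (higson_point :: 'a \<Rightarrow> _)"
    by (auto simp: continuous_map_componentwise higson_point_def higson_functions_def bcontfun_def)
  then have "compactin higson_product (higson_point ` K)"
    by (rule image_compactin[rotated]) (simp add: \<open>compact K\<close>)
  moreover have "Hausdorff_space (higson_product :: (('a \<Rightarrow> complex) \<Rightarrow> complex) topology)"
    by (simp add: Hausdorff_space_product_topology)
  ultimately have "closedin higson_product (higson_point ` K)"
    by (simp add: compactin_imp_closedin)
  then have "higson_product closure_of (higson_point ` (A \<inter> K)) \<subseteq> higson_point ` K"
    by (intro closure_of_minimal) auto
  moreover have "higson_point ` A = higson_point ` (A \<inter> K) \<union> higson_point ` (A - K)" by auto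
  ultimately show ?thesis
    using cl assms(3) unfolding closure_of_higson_points by (auto simp: closure_of_Un)
qed

lemma higson_boundary_mono_neighborhood:
  fixes A B :: "'a::metric_space set"
  assumes proper: "\<And>(z::'a) r. compact (cball z r)" and "closed A"
    and sub: "A \<subseteq> (\<Union>b\<in>B. ball b C)" and "C > 0"
  shows "higson_boundary A \<subseteq> higson_boundary B"
proof
  fix \<phi> assume \<phi>: "\<phi> \<in> higson_boundary A"
  \<comment> \<open>Closedness of \<open>A\<close> excludes evaluations at all points of the space,
    so in particular those at points of \<open>B\<close>.\<close>
  then have "\<phi> \<in> higson_corona"
    using higson_boundary_subset_corona[OF proper \<open>closed A\<close>] by blast
  then have n: "\<phi> \<notin> range higson_point" by (simp add: higson_corona_def)
  have cl: "\<phi> \<in> higson_compactification closure_of (higson_point ` A)"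
    using \<phi> by (simp add: higson_boundary_def)
  have "\<phi> \<in> higson_compactification closure_of (higson_point ` B)"
    unfolding in_closure_higson_points_iff
  proof (intro conjI allI impI)
    show "\<phi> \<in> topspace higson_product"
      using cl unfolding in_closure_higson_points_iff by blast
    fix F :: "('a \<Rightarrow> complex) set" and e :: real
    assume F: "finite F" "F \<subseteq> higson_functions" and "e > 0"
    have "\<forall>f\<in>F. \<forall>\<^sub>F x in at_infty. \<forall>y. dist x y \<le> C \<longrightarrow> cmod (f x - f y) < e / 2"
      using F(2) \<open>e > 0\<close> \<open>C > 0\<close> by (intro ballI higson_functionsD) auto
    then have "\<forall>\<^sub>F x in at_infty. \<forall>f\<in>F. \<forall>y. dist x y \<le> C \<longrightarrow> cmod (f x - f y) < e / 2"
      using F(1) by (simp add: eventually_ball_finite)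
    \<comment> \<open>Finiteness of \<open>F\<close> allows one compact set to serve all its
      members. Half of \<open>e\<close> is spent on the move from \<open>a\<close> to
      \<open>b\<close>, half on approximating \<open>\<phi>\<close> at \<open>a\<close>.\<close>
    then obtain K where K: "compact K"
      "\<And>x f y. x \<notin> K \<Longrightarrow> f \<in> F \<Longrightarrow> dist x y \<le> C \<Longrightarrow> cmod (f x - f y) < e / 2"
      unfolding eventually_at_infty by blast
    obtain a where a: "a \<in> A - K" "\<And>f. f \<in> F \<Longrightarrow> cmod (f a - \<phi> f) < e / 2"
      using higson_corona_closure_avoids_compact[OF K(1) cl n, unfolded in_closure_higson_points_iff,
          THEN conjunct2, rule_format, OF F half_gt_zero[OF \<open>e > 0\<close>]] by blast
    obtain b where b: "b \<in> B" "dist a b \<le> C"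
      using a(1) subsetD[OF sub, of a] by (auto simp: dist_commute intro: less_imp_le)
    have "cmod (f b - \<phi> f) < e" if "f \<in> F" for f
      using a(2)[OF that] K(2)[OF _ that b(2)] a(1)
        norm_triangle_ineq[of "f b - f a" "f a - \<phi> f"]
      by (simp add: norm_minus_commute)
    with b(1) show "\<exists>b\<in>B. \<forall>f\<in>F. cmod (f b - \<phi> f) < e" by blast
  qed
  with n show "\<phi> \<in> higson_boundary B" by (auto simp: higson_boundary_def)
qed

section \<open>Separating coarsely distinct sets at infinity\<close>

lemma infdist_less_iff:
  assumes "A \<noteq> {}"
  shows "infdist x A < r \<longleftrightarrow> (\<exists>a\<in>A. dist x a < r)"
  unfolding infdist_notempty[OF assms]
  by (rule cINF_less_iff[OF assms bdd_belowI2[where m = 0]]) simp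

text \<open>Bolzano-Weierstrass in a compact box gives a limit point of the image of
  \<open>S\<close>. It is no evaluation, since every point has a ball containing no other point of
  \<open>S\<close>.\<close>

lemma higson_corona_accumulation_point:
  fixes S :: "'a::metric_space set"
  assumes proper: "\<And>(z::'a) r. compact (cball z r)"
    and "infinite S" and fin: "\<And>x r. finite (S \<inter> ball x r)"
  obtains \<phi> where "\<phi> \<in> higson_compactification closure_of (higson_point ` S)"
    "\<phi> \<notin> range higson_point"
proof -
  have "\<forall>f\<in>higson_functions. \<exists>b. \<forall>x::'a. cmod (f x) \<le> b"
    by (auto simp: higson_functions_def bcontfun_def bounded_iff)
  then obtain b where b: "\<And>f (x::'a). f \<in> higson_functions \<Longrightarrow> cmod (f x) \<le> b f" by metis
  \<comment> \<open>A product of closed discs, compact by Tychonoff, stands in for compactness of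
    the compactification.\<close>
  define Q where "Q = (\<Pi>\<^sub>E f\<in>higson_functions. cball (0::complex) (b (f :: 'a \<Rightarrow> complex)))"
  have Q: "compactin higson_product Q"
    unfolding Q_def by (simp add: compactin_PiE)
  have sub: "higson_point ` S \<subseteq> Q"
    using b by (auto simp: Q_def higson_point_def)
  define bump :: "'a \<Rightarrow> real \<Rightarrow> 'a \<Rightarrow> complex" where
    "bump = (\<lambda>x e y. of_real (max 0 (e - dist x y)))"
  have bump: "bump x e \<in> higson_functions" if "e > 0" for x e
    unfolding bump_def by (rule bump_in_higson_functions[OF proper that])
  have bump0: "bump x e y \<noteq> 0 \<longleftrightarrow> y \<in> ball x e" for x y e
    by (auto simp: bump_def max_def)
  have "inj_on higson_point S"
  proof (rule inj_onI, rule ccontr)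
    fix x y :: 'a assume eq: "higson_point x = higson_point y" and "x \<noteq> y"
    \<comment> \<open>With radius \<open>dist x y\<close> the bump is positive at \<open>x\<close>
      and vanishes at \<open>y\<close>.\<close>
    then have "bump x (dist x y) \<in> higson_functions" by (intro bump) auto
    then have "bump x (dist x y) x = bump x (dist x y) y"
      using fun_cong[OF eq, of "bump x (dist x y)"] by (simp add: higson_point_def)
    then show False using \<open>x \<noteq> y\<close> by (simp add: bump_def)
  qed
  with \<open>infinite S\<close> sub have "infinite (higson_point ` S) \<and> higson_point ` S \<subseteq> Q"
    by (simp add: finite_image_iff)
  then obtain \<phi> where \<phi>: "\<phi> \<in> higson_product derived_set_of (higson_point ` S)"
    using compactin_imp_Bolzano_Weierstrass[OF Q] by blast
  have "\<phi> \<noteq> higson_point x" for x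
  proof
    assume eq: "\<phi> = higson_point x"
    obtain d where d: "d > 0" "\<And>s. s \<in> S \<inter> ball x 1 \<Longrightarrow> s \<noteq> x \<Longrightarrow> d \<le> dist x s"
      using finite_set_avoid[OF fin] by metis
    \<comment> \<open>The cap at 1 keeps \<open>ball x e\<close> within the unit ball, where
      \<open>d\<close> bounds the distance from \<open>x\<close> to the other points of
      \<open>S\<close> from below.\<close>
    define e where "e = min d 1"
    have e: "e > 0" using d by (simp add: e_def)
    define T where "T = {\<psi> \<in> topspace higson_product. \<psi> (bump x e) \<in> - {0}}"
    have "openin higson_product T"
      unfolding T_def by (rule openin_continuous_map_preimage[OF continuous_map_eval[OF bump[OF e]]]) auto
    moreover have "\<phi> \<in> T"
      using bump[OF e, of x] bump0[of x e x] e by (simp add: T_def eq higson_point_def)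
    ultimately obtain s where s: "s \<in> S" "higson_point s \<in> T" "higson_point s \<noteq> higson_point x"
      using \<phi> unfolding in_derived_set_of eq by blast
    then have "s \<in> ball x e"
      using bump[OF e, of x] bump0[of x e s] by (simp add: T_def higson_point_def)
    with s d(2)[of s] show False by (auto simp: e_def)
  qed
  moreover have "\<phi> \<in> higson_compactification closure_of (higson_point ` S)"
    unfolding closure_of_higson_points by (rule subsetD[OF derived_set_of_subset_closure_of \<phi>])
  ultimately show ?thesis using that by blast
qed

text \<open>
  The quotient below varies by at most \<open>3 r / (1 + u + v)\<close> on \<open>r\<close>-balls, where \<open>u\<close> and \<open>v\<close> are the
  distances to \<open>B\<close> and \<open>S\<close>; the sublevel sets of \<open>u + v\<close> are bounded because only finitely many
  points of \<open>S\<close> lie within a given distance of \<open>B\<close>.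
\<close>

lemma infdist_quotient_in_higson_functions:
  fixes B S :: "'a::metric_space set"
  assumes proper: "\<And>(z::'a) r. compact (cball z r)" and "B \<noteq> {}" "S \<noteq> {}"
    and fin: "\<And>r. finite {s \<in> S. infdist s B \<le> r}"
  shows "(\<lambda>x. of_real (infdist x B / (1 + infdist x B + infdist x S))) \<in> higson_functions"
    (is "?f \<in> _")
proof -
  define u v where "u x = infdist x B" and "v x = infdist x S" for x
  define g where "g x = u x / (1 + u x + v x)" for x
  have nn: "u x \<ge> 0" "v x \<ge> 0" for x by (auto simp: u_def v_def infdist_nonneg)
  have lip: "\<bar>u x - u y\<bar> \<le> dist x y" "\<bar>v x - v y\<bar> \<le> dist x y" for x y
    unfolding u_def v_def by (rule infdist_triangle_abs)+
  have g01: "0 \<le> g x" "g x \<le> 1" for x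
    using nn[of x] by (auto simp: g_def divide_simps)
  have f: "?f x = of_real (g x)" for x by (simp add: g_def u_def v_def)
  have var: "\<bar>g x - g y\<bar> \<le> 3 * dist x y / (1 + u x + v x)" for x y
  proof -
    have pos: "1 + u x + v x > 0" "1 + u y + v y > 0" using nn[of x] nn[of y] by auto
    have gy: "g y * (1 + u y + v y) = u y" using pos by (simp add: g_def)
    \<comment> \<open>Clearing only the denominator at \<open>x\<close> leaves one Lipschitz term
      from the numerator and two, weighted by \<open>g y\<close> in [0, 1], from the denominators;
      this is the constant 3.\<close>
    have "(g x - g y) * (1 + u x + v x) = u x - u y + g y * ((u y - u x) + (v y - v x))"
    proof -
      have "g x * (1 + u x + v x) = u x" using pos by (simp add: g_def)
      then show ?thesis using gy by (simp add: algebra_simps)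
    qed
    moreover have "\<bar>g y * ((u y - u x) + (v y - v x))\<bar> \<le> 1 * (2 * dist x y)"
      unfolding abs_mult using lip[of x y] g01[of y] by (intro mult_mono) auto
    ultimately have "\<bar>(g x - g y) * (1 + u x + v x)\<bar> \<le> 3 * dist x y"
      using lip[of x y] by linarith
    then show ?thesis using pos by (simp add: abs_mult pos_le_divide_eq)
  qed
  have large: "\<forall>\<^sub>F x in at_infty. u x + v x > R" for R
  proof -
    obtain s0 where "s0 \<in> S" using \<open>S \<noteq> {}\<close> by blast
    \<comment> \<open>If \<open>u x + v x\<close> is at most \<open>R\<close>, some \<open>s\<close>
      in \<open>S\<close> lies within \<open>R + 1\<close> of \<open>x\<close>, the extra 1 covering
      an infimum that need not be attained. Then \<open>s\<close> is within
      \<open>R + (R + 1)\<close> of \<open>B\<close>.\<close>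
    define T where "T = insert s0 {s \<in> S. infdist s B \<le> 2 * R + 1}"
    have "finite T" unfolding T_def using fin by simp
    then have "compact (\<Union>s\<in>T. cball s (R + 1))" using proper by (intro compact_UN)
    moreover have "u x + v x > R" if x: "x \<notin> (\<Union>s\<in>T. cball s (R + 1))" for x
    proof (rule ccontr)
      assume "\<not> u x + v x > R"
      then have le: "u x \<le> R" "v x \<le> R" "u x + v x \<le> R" using nn[of x] by auto
      have "infdist x S < R + 1" using le by (simp add: v_def)
      then obtain s where s: "s \<in> S" "dist x s < R + 1"
        using infdist_less_iff[OF \<open>S \<noteq> {}\<close>] by auto
      have "infdist s B \<le> 2 * R + 1"
        using lip(1)[of x s] s(2) le(1) by (auto simp: u_def)
      then have "s \<in> T" using s by (simp add: T_def)
      with x s show False by (auto simp: dist_commute)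
    qed
    ultimately show ?thesis unfolding eventually_at_infty by blast
  qed
  have "\<forall>\<^sub>F x in at_infty. \<forall>y. dist x y \<le> r \<longrightarrow> cmod (?f x - ?f y) < e"
    if "r > 0" "e > 0" for r e
    \<comment> \<open>Beyond this threshold the bound \<open>3 * r / (1 + u x + v x)\<close> drops
      below \<open>e\<close>.\<close>
    using large[of "3 * r / e"]
  proof eventually_elim
    case (elim x)
    show ?case
    proof (intro allI impI)
      fix y assume "dist x y \<le> r"
      have pos: "1 + u x + v x > 0" using nn[of x] by simp
      have "\<bar>g x - g y\<bar> \<le> 3 * r / (1 + u x + v x)"
        by (rule order_trans[OF var divide_right_mono]) (use \<open>dist x y \<le> r\<close> pos in auto)
      also have "\<dots> < e"
        using elim \<open>e > 0\<close> pos by (simp add: field_simps)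
      finally show "cmod (?f x - ?f y) < e"
        unfolding f by (simp only: of_real_diff[symmetric] norm_of_real)
    qed
  qed
  moreover have "?f \<in> bcontfun"
  proof -
    have "1 + infdist x B + infdist x S \<noteq> 0" for x
      using infdist_nonneg[of x B] infdist_nonneg[of x S] by linarith
    then have "continuous_on UNIV ?f"
      by (intro continuous_intros ballI)
    moreover have "bounded (range ?f)"
      unfolding f bounded_iff using g01 by (auto intro!: exI[of _ 1])
    ultimately show ?thesis by (simp add: bcontfun_def)
  qed
  ultimately show ?thesis by (simp add: higson_functions_iff)
qed

text \<open>Otherwise a sequence in \<open>A\<close> receding from \<open>B\<close> has a limit in
  the corona. The hypothesis puts it in the closure of \<open>B\<close>, although a Higson function
  separates the sequence from \<open>B\<close>.\<close>

lemma neighborhood_of_higson_boundary_subset: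
  fixes A B :: "'a::metric_space set"
  assumes proper: "\<And>(z::'a) r. compact (cball z r)" and "B \<noteq> {}"
    and sub: "higson_boundary A \<subseteq> higson_boundary B"
  shows "\<exists>C>0. A \<subseteq> (\<Union>b\<in>B. ball b C)"
proof (rule ccontr)
  assume neg: "\<not> ?thesis"
  \<comment> \<open>The successor makes every radius positive and keeps all chosen points at
    distance at least 1 from \<open>B\<close>, which is used for the lower bound on
    \<open>f\<close>.\<close>
  have "\<exists>a\<in>A. infdist a B \<ge> real (Suc n)" for n
  proof (rule ccontr)
    assume "\<not> ?thesis"
    then have "A \<subseteq> (\<Union>b\<in>B. ball b (real (Suc n)))"
      using infdist_less_iff[OF \<open>B \<noteq> {}\<close>] by (fastforce simp: dist_commute not_le)
    with neg show False by (metis of_nat_0_less_iff zero_less_Suc)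
  qed
  then obtain a where a: "\<And>n. a n \<in> A" "\<And>n. infdist (a n) B \<ge> real (Suc n)" by metis
  define S where "S = range a"
  have fin: "finite {s \<in> S. infdist s B \<le> r}" for r
  proof (rule finite_subset)
    show "{s \<in> S. infdist s B \<le> r} \<subseteq> a ` {..nat \<lceil>r\<rceil>}"
    proof
      fix s assume "s \<in> {s \<in> S. infdist s B \<le> r}"
      then obtain n where n: "s = a n" "infdist (a n) B \<le> r" by (auto simp: S_def)
      have "n \<le> nat \<lceil>r\<rceil>" using n(2) a(2)[of n] by linarith
      with n show "s \<in> a ` {..nat \<lceil>r\<rceil>}" by blast
    qed
  qed simp
  have "infinite S"
  proof
    assume "finite S"
    then obtain r where "\<And>s. s \<in> S \<Longrightarrow> infdist s B \<le> r"
      using bounded_imp_bdd_above[OF finite_imp_bounded, of "(\<lambda>s. infdist s B) ` S"]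
      by (force simp: bdd_above_def)
    then have "infdist (a (nat \<lceil>r\<rceil>)) B \<le> r" by (simp add: S_def)
    then show False using a(2)[of "nat \<lceil>r\<rceil>"] by linarith
  qed
  \<comment> \<open>The distance to \<open>B\<close> is 1-Lipschitz, so a ball lies in one of its
    sublevel sets.\<close>
  moreover have "finite (S \<inter> ball x r)" for x r
  proof (rule finite_subset[OF _ fin[of "infdist x B + r"]])
    show "S \<inter> ball x r \<subseteq> {s \<in> S. infdist s B \<le> infdist x B + r}"
    proof clarsimp
      fix s assume "dist x s < r"
      then show "infdist s B \<le> infdist x B + r"
        using infdist_triangle[of s B x] by (simp add: dist_commute)
    qed
  qed
  ultimately obtain \<phi> where \<phi>: "\<phi> \<in> higson_compactification closure_of (higson_point ` S)"
    "\<phi> \<notin> range higson_point"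
    using higson_corona_accumulation_point[OF proper] by blast
  have "higson_point ` S \<subseteq> higson_point ` A" using a(1) by (auto simp: S_def)
  then have "\<phi> \<in> higson_boundary A"
    using \<phi> closure_of_mono unfolding higson_boundary_def by blast
  then have \<phi>B: "\<phi> \<in> higson_compactification closure_of (higson_point ` B)"
    using sub by (auto simp: higson_boundary_def)
  define f :: "'a \<Rightarrow> complex" where
    "f = (\<lambda>x. of_real (infdist x B / (1 + infdist x B + infdist x S)))"
  have f: "f \<in> higson_functions"
    unfolding f_def
    by (rule infdist_quotient_in_higson_functions[OF proper \<open>B \<noteq> {}\<close> _ fin]) (simp add: S_def)
  have approx: "\<exists>p\<in>P. cmod (f p - \<phi> f) < 1 / 4"
    if "\<phi> \<in> higson_compactification closure_of (higson_point ` P)" for P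
    using that f unfolding in_closure_higson_points_iff
    by (auto dest!: spec[of _ "{f}"] spec[of _ "1 / 4"])
  \<comment> \<open>Both values lie within 1/4 of \<open>\<phi> f\<close>, yet \<open>f\<close> is 0
    on \<open>B\<close> and, being \<open>u / (1 + u)\<close> with \<open>u\<close> at least 1, at
    least 1/2 on \<open>S\<close>.\<close>
  obtain s b where s: "s \<in> S" "cmod (f s - \<phi> f) < 1 / 4" and b: "b \<in> B" "cmod (f b - \<phi> f) < 1 / 4"
    using approx[OF \<phi>(1)] approx[OF \<phi>B] by blast
  have "f b = 0" using b by (simp add: f_def)
  moreover have "cmod (f s) \<ge> 1 / 2"
  proof -
    obtain n where "s = a n" using s(1) by (auto simp: S_def)
    then have "infdist s B \<ge> 1" using a(2)[of n] by simp
    moreover have "infdist s S = 0" using s(1) by simp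
    ultimately show ?thesis by (simp add: f_def norm_divide field_simps del: of_real_divide)
  qed
  ultimately show False
    using s(2) b(2) norm_triangle_ineq2[of "f s" "\<phi> f"] by simp
qed

theorem proposition3p2:
  fixes A B :: "'a::metric_space set"
  assumes "locally compact (UNIV :: 'a set)"
    and proper: "\<And>(x::'a) r. compact (cball x r)"
    and "closed A" and "A \<noteq> {}"
    and "closed B" and "B \<noteq> {}"
  shows "(double_class (set_metric A) = double_class (set_metric B) \<longleftrightarrow>
            (\<exists>C>0. A \<subseteq> (\<Union>b\<in>B. ball b C) \<and> B \<subseteq> (\<Union>a\<in>A. ball a C))) \<and>
         ((\<exists>C>0. A \<subseteq> (\<Union>b\<in>B. ball b C) \<and> B \<subseteq> (\<Union>a\<in>A. ball a C)) \<longleftrightarrow>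
            higson_boundary A = higson_boundary B)"
proof (rule conjI[OF double_class_set_metric_eq_iff[OF \<open>A \<noteq> {}\<close> \<open>B \<noteq> {}\<close>]], rule iffI)
  assume "\<exists>C>0. A \<subseteq> (\<Union>b\<in>B. ball b C) \<and> B \<subseteq> (\<Union>a\<in>A. ball a C)"
  then show "higson_boundary A = higson_boundary B"
    using higson_boundary_mono_neighborhood[OF proper \<open>closed A\<close>]
      higson_boundary_mono_neighborhood[OF proper \<open>closed B\<close>] by blast
next
  assume eq: "higson_boundary A = higson_boundary B"
  obtain C where C: "C > 0" "A \<subseteq> (\<Union>b\<in>B. ball b C)"
    using neighborhood_of_higson_boundary_subset[OF proper \<open>B \<noteq> {}\<close>] eq by blast
  obtain D where D: "D > 0" "B \<subseteq> (\<Union>a\<in>A. ball a D)"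
    using neighborhood_of_higson_boundary_subset[OF proper \<open>A \<noteq> {}\<close>] eq by blast
  \<comment> \<open>Each boundary inclusion gave its own radius; the maximum serves both
    directions.\<close>
  show "\<exists>C>0. A \<subseteq> (\<Union>b\<in>B. ball b C) \<and> B \<subseteq> (\<Union>a\<in>A. ball a C)"
    using C(1) neighborhood_mono[OF C(2), of "max C D"] neighborhood_mono[OF D(2), of "max C D"]
    by (intro exI[of _ "max C D"]) auto
qed

end
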